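(* Let $\mathbf L=(L,\vee,\wedge)$ be a semimodular $\lambda$-lattice satisfying the following three conditions: (1) for all $x,y,z\in L$, if $x\parallel y$, $x\parallel z$ and $y\prec z$, then $x\wedge y\leq x\wedge z$; (2) for all $x,y,z\in L$, if $x\parallel y$, $x<z$ and $y\prec z$, then $z\not< x\vee y$; (3) the poset $(L,\leq)$ satisfies the descending chain condition. Then $\mathbf L$ satisfies the lower covering condition.
   Context: A $\lambda$-lattice is an algebra $(L,\vee,\wedge)$ with two binary operations satisfying the identities: (i) $x\vee y=y\vee x$ and $x\wedge y=y\wedge x$ (commutativity); (ii) $x\vee((x\vee y)\vee z)=(x\vee y)\vee z$ and $x\wedge((x\wedge y)\wedge z)=(x\wedge y)\wedge z$ (weak associativity); (iii) $x\vee(x\wedge y)=x$ and $x\wedge(x\vee y)=x$ (absorption). The relation $x\leq y$ is defined by $x\vee y=y$ (equivalently, $x\wedge y=x$); it is a partial order on $L$, and $x\vee y$ is an upper bound and $x\wedge y$ a lower bound of $\{x,y\}$ (not necessarily the least, respectively greatest, one). Write $x<y$ for $x\leq y$ and $x\neq y$; $x\parallel y$ means that $x$ and $y$ are incomparable (neither $x\leq y$ nor $y\leq x$); $x\prec y$ means that $y$ covers $x$, i.e. $x<y$ and there is no $z\in L$ with $x<z<y$. A $\lambda$-lattice is semimodular if for all $x,y,z\in L$ with $x\parallel y$ and $x\wedge y<z<x$ there exists some $u\in L$ with $x\wedge y<u\leq y$ and $(z\vee u)\wedge x=z$. A $\lambda$-lattice satisfies the lower covering condition if for all $x,y\in L$: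 $x\wedge y\prec x$ implies $y\prec x\vee y$. *)

theory Defs
  imports Main
begin

text \<open>The universe of a \<open>\<lambda>\<close>-lattice is a type; the two operations are arbitrary functions on
  it. Everything order-theoretic is derived from the join alone.\<close>

locale lambda_lattice =
  fixes join :: "'a \<Rightarrow> 'a \<Rightarrow> 'a" (infixl "\<squnion>" 65)
    and meet :: "'a \<Rightarrow> 'a \<Rightarrow> 'a" (infixl "\<sqinter>" 70)
  assumes join_commute: "x \<squnion> y = y \<squnion> x"
    and meet_commute: "x \<sqinter> y = y \<sqinter> x"
    and join_weak_assoc: "x \<squnion> ((x \<squnion> y) \<squnion> z) = (x \<squnion> y) \<squnion> z"
    and meet_weak_assoc: "x \<sqinter> ((x \<sqinter> y) \<sqinter> z) = (x \<sqinter> y) \<sqinter> z"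
    and join_absorb: "x \<squnion> (x \<sqinter> y) = x"
    and meet_absorb: "x \<sqinter> (x \<squnion> y) = x"

definition leq :: "('a \<Rightarrow> 'a \<Rightarrow> 'a) \<Rightarrow> 'a \<Rightarrow> 'a \<Rightarrow> bool" where
  "leq join x y \<longleftrightarrow> join x y = y"

definition lt :: "('a \<Rightarrow> 'a \<Rightarrow> 'a) \<Rightarrow> 'a \<Rightarrow> 'a \<Rightarrow> bool" where
  "lt join x y \<longleftrightarrow> leq join x y \<and> x \<noteq> y"

definition incomparable :: "('a \<Rightarrow> 'a \<Rightarrow> 'a) \<Rightarrow> 'a \<Rightarrow> 'a \<Rightarrow> bool" where
  "incomparable join x y \<longleftrightarrow> \<not> leq join x y \<and> \<not> leq join y x"

text \<open>\<open>covered_by join x y\<close> is \<open>x \<prec> y\<close>: the second element covers the first.\<close>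

definition covered_by :: "('a \<Rightarrow> 'a \<Rightarrow> 'a) \<Rightarrow> 'a \<Rightarrow> 'a \<Rightarrow> bool" where
  "covered_by join x y \<longleftrightarrow> lt join x y \<and> \<not> (\<exists>z. lt join x z \<and> lt join z y)"

definition semimodular :: "('a \<Rightarrow> 'a \<Rightarrow> 'a) \<Rightarrow> ('a \<Rightarrow> 'a \<Rightarrow> 'a) \<Rightarrow> bool" where
  "semimodular join meet \<longleftrightarrow>
    (\<forall>x y z. incomparable join x y \<and> lt join (meet x y) z \<and> lt join z x \<longrightarrow>
      (\<exists>u. lt join (meet x y) u \<and> leq join u y \<and> meet (join z u) x = z))"

definition lower_covering_condition :: "('a \<Rightarrow> 'a \<Rightarrow> 'a) \<Rightarrow> ('a \<Rightarrow> 'a \<Rightarrow> 'a) \<Rightarrow> bool" where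
  "lower_covering_condition join meet \<longleftrightarrow>
    (\<forall>x y. covered_by join (meet x y) x \<longrightarrow> covered_by join y (join x y))"

definition descending_chain_condition :: "('a \<Rightarrow> 'a \<Rightarrow> 'a) \<Rightarrow> bool" where
  "descending_chain_condition join \<longleftrightarrow>
    \<not> (\<exists>f :: nat \<Rightarrow> 'a. \<forall>n. lt join (f (Suc n)) (f n))"

context lambda_lattice
begin

lemma leq_iff_meet: "leq join x y \<longleftrightarrow> x \<sqinter> y = x"
  unfolding leq_def by (metis join_absorb meet_absorb join_commute meet_commute)

sublocale ordering "leq join" "lt join"
proof
  show "leq join x x" for x
    unfolding leq_def by (metis join_absorb meet_absorb)
  show "leq join x z" if "leq join x y" "leq join y z" for x y z
    using that unfolding leq_def by (metis join_weak_assoc)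
  show "x = y" if "leq join x y" "leq join y x" for x y
    using that unfolding leq_def by (metis join_commute)
  show "lt join x y \<longleftrightarrow> leq join x y \<and> x \<noteq> y" for x y
    by (simp add: lt_def)
qed

end

end

theory Submission
  imports Defs
begin

text \<open>If \<open>x \<sqinter> y \<prec> x\<close> but \<open>x \<squnion> y\<close> does not cover \<open>y \<parallel> x\<close>, the descending chain condition gives
  \<open>z\<close> with \<open>y \<prec> z < x \<squnion> y\<close>. Condition (2) forces \<open>x \<parallel> z\<close>, and then condition (1) forces
  \<open>x \<sqinter> z = x \<sqinter> y\<close>. Semimodularity applied to \<open>z \<sqinter> x < y < z\<close> yields \<open>u\<close> with
  \<open>x \<sqinter> y < u \<le> x\<close>, so \<open>u = x\<close>, and \<open>y = (y \<squnion> u) \<sqinter> z = z\<close>, a contradiction.\<close>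

text \<open>The descending chain condition is well-foundedness of \<open>lt join\<close>, used below
  in its minimal-element form.\<close>

lemma descending_chain_condition_minimal:
  assumes dcc: "descending_chain_condition join" and "P a"
  obtains m where "P m" and "\<And>w. lt join w m \<Longrightarrow> \<not> P w"
proof -
  have "wf {(w, m). lt join w m}"
    using dcc unfolding descending_chain_condition_def wf_iff_no_infinite_down_chain by simp
  then obtain m where "m \<in> Collect P" "\<And>w. (w, m) \<in> {(w, m). lt join w m} \<Longrightarrow> w \<notin> Collect P"
    using \<open>P a\<close> wfE_min[of _ a "Collect P"] by blast
  then show thesis
    using that by auto
qed

context lambda_lattice
begin

lemma meet_leq1: "leq join (x \<sqinter> y) x"
  unfolding leq_def by (metis join_absorb join_commute)

lemma meet_leq2: "leq join (x \<sqinter> y) y"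
  by (metis meet_leq1 meet_commute)

lemma leq_join1: "leq join x (x \<squnion> y)"
  by (simp add: leq_iff_meet meet_absorb)

lemma leq_join2: "leq join y (x \<squnion> y)"
  by (metis leq_join1 join_commute)

text \<open>A minimal \<open>w\<close> with \<open>y < w \<le> z\<close> covers \<open>y\<close>:
  anything strictly between \<open>y\<close> and \<open>w\<close> would still lie below
  \<open>z\<close>.\<close>

lemma exists_cover_below:
  assumes "descending_chain_condition join" "lt join y z"
  obtains w where "covered_by join y w" "leq join w z"
proof -
  obtain w where w: "lt join y w \<and> leq join w z"
    and min: "\<And>v. lt join v w \<Longrightarrow> \<not> (lt join y v \<and> leq join v z)"
    using descending_chain_condition_minimal[OF assms(1), of "\<lambda>w. lt join y w \<and> leq join w z" z]
      assms(2) refl by blast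
  have "covered_by join y w"
    unfolding covered_by_def using w min by (meson strict_implies_order trans)
  then show thesis
    using that w by blast
qed

end

theorem theorem2p13:
  fixes join meet :: "'a \<Rightarrow> 'a \<Rightarrow> 'a"
  assumes "lambda_lattice join meet"
    and "semimodular join meet"
    and "\<forall>x y z. incomparable join x y \<and> incomparable join x z \<and> covered_by join y z \<longrightarrow>
           leq join (meet x y) (meet x z)"
    and "\<forall>x y z. incomparable join x y \<and> lt join x z \<and> covered_by join y z \<longrightarrow>
           \<not> lt join z (join x y)"
    and "descending_chain_condition join"
  shows "lower_covering_condition join meet"
  unfolding lower_covering_condition_def
proof (intro allI impI)
  interpret lambda_lattice join meet by fact
  fix x y
  assume cov: "covered_by join (meet x y) x"
  have between: "w = x" if "lt join (meet x y) w" "leq join w x" for w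
    using cov that unfolding covered_by_def lt_def by blast
  have nxy: "\<not> leq join x y"
    using cov unfolding covered_by_def lt_def leq_iff_meet by blast
  show "covered_by join y (join x y)"
  proof (cases "leq join y x")
    case True
    then have "meet x y = y" "join x y = x"
      by (metis leq_iff_meet meet_commute, metis True leq_def join_commute)
    then show ?thesis
      using cov by simp
  next
    case False
    with nxy have inc: "incomparable join x y"
      by (simp add: incomparable_def)
    have lt_xy: "lt join y (join x y)"
      using nxy leq_join1 leq_join2 unfolding lt_def by metis
    show ?thesis
    proof (rule ccontr)
      assume "\<not> ?thesis"
      with lt_xy obtain z' where "lt join y z'" and z': "lt join z' (join x y)"
        unfolding covered_by_def by blast
      then obtain z where yz: "covered_by join y z" and "leq join z z'"
        using exists_cover_below[OF assms(5)] by metis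
      with z' have zlt: "lt join z (join x y)"
        by (metis strict_trans1)
      have "leq join y z" "y \<noteq> z" "lt join y z"
        using yz by (auto simp: covered_by_def lt_def)
      have "\<not> leq join z x"
        using False \<open>leq join y z\<close> trans by blast
      \<comment> \<open>\<open>x = z\<close> is impossible, as \<open>y\<close> lies below
        \<open>z\<close> but not below \<open>x\<close>; so \<open>x \<le> z\<close> would give
        \<open>x < z\<close>, contrary to condition (2).\<close>
      moreover have "\<not> leq join x z"
        using assms(4) inc yz zlt \<open>leq join y z\<close> False unfolding lt_def by blast
      ultimately have incz: "incomparable join x z" "incomparable join z x"
        by (auto simp: incomparable_def)
      have "leq join (meet x y) (meet x z)"
        using assms(3) inc incz yz by blast
      moreover have "meet x z \<noteq> x"
        using \<open>\<not> leq join x z\<close> by (simp add: leq_iff_meet)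
      \<comment> \<open>If \<open>meet x z\<close> were strictly above \<open>meet x y\<close>,
        \<open>between\<close> would make it equal to \<open>x\<close>.\<close>
      ultimately have "meet z x = meet x y"
        using between[OF _ meet_leq1] meet_commute unfolding lt_def by metis
      moreover have "lt join (meet x y) y"
        using False meet_leq1 meet_leq2 unfolding lt_def by metis
      \<comment> \<open>Semimodularity is instantiated with \<open>z\<close>, \<open>x\<close>,
        \<open>y\<close> in the roles of its \<open>x\<close>, \<open>y\<close>,
        \<open>z\<close>.\<close>
      ultimately obtain u where "lt join (meet x y) u" "leq join u x" "meet (join y u) z = y"
        using assms(2) incz \<open>lt join y z\<close> unfolding semimodular_def by metis
      then have "meet (join y x) z = y"
        using between by blast
      \<comment> \<open>Here \<open>z\<close> lies below \<open>join x y\<close> by its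
        choice.\<close>
      moreover have "meet (join y x) z = z"
        using zlt by (metis lt_def leq_iff_meet join_commute meet_commute)
      ultimately show False
        using \<open>y \<noteq> z\<close> by simp
    qed
  qed
qed

end
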